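(* Let \[ F(x,y,z,p,q)=\sum_{P}x^{\mathrm{col}(P)}y^{\mathrm{row}(P)}z^{\mathrm{area}(P)}p^{\mathrm{edgint}(P)}q^{\mathrm{point}(P)}, \] the sum running over all (non-empty) Stanley polyominoes $P$. Then \[ F(x,y,z,p,q)=\frac{G(x,y,z,p,q)}{1+H(x,y,z,p,q)}, \] where \begin{align*} G(x,y,z,p,q)&=\sum_{\ell\geq 0}\frac{x^{\ell+2}y^{\ell+2}(pq)^{\frac{\ell(\ell+3)}{2}}(p-1)z^{\frac{(\ell+3)(\ell+2)}{2}}-y^{\ell+1}x^{\ell+1}z^{\frac{(\ell+2)(\ell+1)}{2}}(pq)^{\frac{\ell(\ell+1)}{2}}p}{p^{2\ell+1}q^{\ell}\left(xz(zpq)^{\ell}-1\right)}\,\Delta_\ell,\\ H(x,y,z,p,q)&=\sum_{\ell\geq 0}\frac{\left(-(pq)^{\frac{\ell(\ell+3)}{2}}z^{\frac{(\ell+4)(\ell+1)}{2}}+z^{\frac{(\ell+6)(\ell+1)}{2}}q(p-1)(pq)^{\frac{\ell(\ell+5)}{2}}\right)x^{\ell+1}y^{\ell+1}}{p^{2\ell}q^{\ell}\left(xz(zpq)^{\ell}-1\right)\left((zpq)^{\ell}zqp-1\right)}\,\Delta_\ell,\\ \Delta_\ell&=\frac{1}{\prod_{i=0}^{\ell-1}\left(1-xz(zpq)^{i}\right)\prod_{i=0}^{\ell-1}\left((zpq)^{i}zqp-1\right)}=\frac{(-1)^\ell}{(xz,zpq)_\ell\,(zpq,zpq)_\ell}.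 \end{align*}
   Context: Cells are unit squares $[i,i+1]\times[j,j+1]$ with $i,j\in\mathbb{Z}$. A Stanley polyomino (considered up to translation) is a set of cells forming $k\geq 1$ rows $0,1,\dots,k-1$ (from bottom to top), where row $j$ consists of the cells $[i,i+1]\times[j,j+1]$ with $s_j\le i\le e_j$ for integers $s_j\le e_j$, such that for $1\le j\le k-1$ we have $s_{j-1}<s_j\le e_{j-1}<e_j$ (each row begins strictly to the right of the beginning of the previous row, ends strictly to the right of the end of the previous row, and consecutive rows share at least one column). For such $P$: $\mathrm{col}(P)=e_{k-1}-s_0+1$ is the number of columns, $\mathrm{row}(P)=k$ the number of rows, $\mathrm{area}(P)$ the number of cells, $\mathrm{point}(P)$ the number of interior points (lattice points belonging to exactly four cells of $P$), and $\mathrm{edgint}(P)$ the number of strictly internal edges (horizontal unit lattice edges both of whose endpoints are interior points of $P$). The Pochhammer symbol is $(a,b)_k=\prod_{j=0}^{k-1}(1-ab^j)$ (empty products equal $1$). *)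

theory Defs
  imports "HOL-Analysis.Analysis" "HOL-Computational_Algebra.Formal_Power_Series"
begin

section \<open>Stanley polyominoes\<close>

text \<open>The pair \<open>(i, j)\<close> stands for the cell $[i,i+1] \times [j,j+1]$ as well as for the lattice
  point with these coordinates.\<close>

definition row_cells :: "nat \<Rightarrow> (nat \<Rightarrow> int) \<Rightarrow> (nat \<Rightarrow> int) \<Rightarrow> (int \<times> int) set" where
  "row_cells k s e = {(i, int j) | i j. j < k \<and> s j \<le> i \<and> i \<le> e j}"

definition stanley_rows :: "nat \<Rightarrow> (nat \<Rightarrow> int) \<Rightarrow> (nat \<Rightarrow> int) \<Rightarrow> bool" where
  "stanley_rows k s e \<longleftrightarrow> k \<ge> 1 \<and> (\<forall>j<k. s j \<le> e j) \<and>
     (\<forall>j. 1 \<le> j \<and> j \<le> k - 1 \<longrightarrow> s (j - 1) < s j \<and> s j \<le> e (j - 1) \<and> e (j - 1) < e j)"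

definition stanley_polyomino :: "(int \<times> int) set \<Rightarrow> bool" where
  "stanley_polyomino P \<longleftrightarrow> (\<exists>k s e. stanley_rows k s e \<and> P = row_cells k s e)"

text \<open>Polyominoes are counted up to translation. Each translation class is represented by its
  unique member whose bottom row, which is row 0, begins in column 0; see
  \<open>stanley_polyomino_ex1_translate\<close> below.\<close>

definition stanley_polyominoes :: "(int \<times> int) set set" where
  "stanley_polyominoes =
     {P. \<exists>k s e. stanley_rows k s e \<and> s 0 = 0 \<and> P = row_cells k s e}"

definition translate :: "int \<times> int \<Rightarrow> (int \<times> int) set \<Rightarrow> (int \<times> int) set" where
  "translate v P = (\<lambda>(i, j). (i + fst v, j + snd v)) ` P"

text \<open>The numbers of occupied columns and rows; \<open>col_of_row_cells\<close> and \<open>row_of_row_cells\<close> below show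
  that these are $e_{k-1} - s_0 + 1$ and $k$.\<close>

definition col_of :: "(int \<times> int) set \<Rightarrow> nat" where
  "col_of P = card (fst ` P)"

definition row_of :: "(int \<times> int) set \<Rightarrow> nat" where
  "row_of P = card (snd ` P)"

definition area_of :: "(int \<times> int) set \<Rightarrow> nat" where
  "area_of P = card P"

definition corners :: "int \<times> int \<Rightarrow> (int \<times> int) set" where
  "corners c = {fst c, fst c + 1} \<times> {snd c, snd c + 1}"

definition interior_points :: "(int \<times> int) set \<Rightarrow> (int \<times> int) set" where
  "interior_points P = {v. card {c \<in> P. v \<in> corners c} = 4}"

definition point_of :: "(int \<times> int) set \<Rightarrow> nat" where
  "point_of P = card (interior_points P)"

text \<open>A horizontal unit edge is identified with its left endpoint \<open>(a, b)\<close>.\<close>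

definition edgint_of :: "(int \<times> int) set \<Rightarrow> nat" where
  "edgint_of P = card {(a, b). (a, b) \<in> interior_points P \<and> (a + 1, b) \<in> interior_points P}"

lemma stanley_rows_mono:
  assumes "stanley_rows k s e" "i \<le> j" "j < k"
  shows "s i \<le> s j \<and> e i \<le> e j"
  using assms(2,3)
proof (induction j rule: dec_induct)
  case base
  then show ?case by simp
next
  case (step n)
  have "s (Suc n - 1) < s (Suc n) \<and> e (Suc n - 1) < e (Suc n)"
    using assms(1) step.prems unfolding stanley_rows_def
    by (metis One_nat_def Suc_le_mono Suc_pred less_Suc_eq_le not_less_zero le0 neq0_conv)
  then show ?case using step by simp
qed

lemma snd_row_cells:
  assumes "stanley_rows k s e"
  shows "snd ` row_cells k s e = int ` {..<k}"
proof -
  have "int j \<in> snd ` row_cells k s e" if "j < k" for j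
  proof -
    have "(s j, int j) \<in> row_cells k s e"
      using assms that by (auto simp: row_cells_def stanley_rows_def)
    then show ?thesis by force
  qed
  then show ?thesis by (auto simp: row_cells_def)
qed

lemma row_of_row_cells:
  assumes "stanley_rows k s e"
  shows "row_of (row_cells k s e) = k"
  by (simp add: row_of_def snd_row_cells[OF assms] card_image)

lemma fst_row_cells:
  assumes "stanley_rows k s e"
  shows "fst ` row_cells k s e = {s 0..e (k - 1)}"
proof -
  have k: "k \<ge> 1" using assms by (simp add: stanley_rows_def)
  have cover: "{s 0..e j} \<subseteq> fst ` row_cells k s e" if "j < k" for j
    using that
  proof (induction j)
    case 0
    then have "(i, int 0) \<in> row_cells k s e" if "i \<in> {s 0..e 0}" for i
      using that unfolding row_cells_def by auto
    then show ?case by force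
  next
    case (Suc j)
    have "s (Suc j) \<le> e j"
      using assms Suc.prems unfolding stanley_rows_def
      by (metis One_nat_def Suc_le_mono Suc_pred diff_Suc_1 le0 less_Suc_eq_le not_less_zero neq0_conv)
    then have "{s 0..e (Suc j)} \<subseteq> {s 0..e j} \<union> {s (Suc j)..e (Suc j)}" by auto
    moreover have "{s (Suc j)..e (Suc j)} \<subseteq> fst ` row_cells k s e"
    proof
      fix i assume "i \<in> {s (Suc j)..e (Suc j)}"
      then have "(i, int (Suc j)) \<in> row_cells k s e"
        using Suc.prems unfolding row_cells_def mem_Collect_eq
        by (intro exI[of _ i] exI[of _ "Suc j"]) auto
      then show "i \<in> fst ` row_cells k s e" by force
    qed
    ultimately show ?case using Suc by auto
  qed
  have "s 0 \<le> i \<and> i \<le> e (k - 1)" if cell: "(i, j) \<in> row_cells k s e" for i j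
  proof -
    obtain n where n: "n < k" "s n \<le> i" "i \<le> e n"
      using cell by (auto simp: row_cells_def)
    have "s 0 \<le> s n" "e n \<le> e (k - 1)"
      using stanley_rows_mono[OF assms, of 0 n] stanley_rows_mono[OF assms, of n "k - 1"] n(1) k
      by auto
    then show ?thesis using n by simp
  qed
  then have "fst ` row_cells k s e \<subseteq> {s 0..e (k - 1)}" by force
  with cover[of "k - 1"] k show ?thesis by auto
qed

lemma col_of_row_cells:
  assumes "stanley_rows k s e"
  shows "int (col_of (row_cells k s e)) = e (k - 1) - s 0 + 1"
proof -
  have "s 0 \<le> s (k - 1)" "s (k - 1) \<le> e (k - 1)"
    using stanley_rows_mono[OF assms, of 0 "k - 1"] assms by (auto simp: stanley_rows_def)
  then show ?thesis by (simp add: col_of_def fst_row_cells[OF assms])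
qed

lemma fst_translate: "fst ` translate v P = (\<lambda>i. i + fst v) ` fst ` P"
  and snd_translate: "snd ` translate v P = (\<lambda>j. j + snd v) ` snd ` P"
  by (force simp: translate_def image_image case_prod_beta)+

lemma Min_snd_row_cells:
  assumes "stanley_rows k s e"
  shows "Min (snd ` row_cells k s e) = 0"
  using assms unfolding snd_row_cells[OF assms]
  by (intro Min_eqI) (auto simp: stanley_rows_def image_iff intro!: bexI[of _ 0])

lemma Min_fst_row_cells:
  assumes "stanley_rows k s e"
  shows "Min (fst ` row_cells k s e) = s 0"
proof -
  have "s 0 \<le> s (k - 1)" "s (k - 1) \<le> e (k - 1)"
    using stanley_rows_mono[OF assms, of 0 "k - 1"] assms by (auto simp: stanley_rows_def)
  then show ?thesis unfolding fst_row_cells[OF assms] by (intro Min_eqI) auto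
qed

lemma stanley_polyomino_ex1_translate:
  assumes "stanley_polyomino P"
  shows "\<exists>!Q. Q \<in> stanley_polyominoes \<and> (\<exists>v. P = translate v Q)"
proof -
  obtain k s e where ok: "stanley_rows k s e" and P: "P = row_cells k s e"
    using assms by (auto simp: stanley_polyomino_def)
  have inv: "translate (- fst v, - snd v) (translate v Q) = Q" for v Q
    by (simp add: translate_def image_image case_prod_beta)
  have v: "v = (s 0, 0)" if Q: "Q \<in> stanley_polyominoes" and PQ: "P = translate v Q" for v Q
  proof -
    obtain k' s' e' where ok': "stanley_rows k' s' e'" "s' 0 = 0" and Q: "Q = row_cells k' s' e'"
      using Q by (auto simp: stanley_polyominoes_def)
    have k': "0 < k'" using ok' by (auto simp: stanley_rows_def)
    have "s' 0 \<le> e' (k' - 1)"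
      using stanley_rows_mono[OF ok'(1), of 0 "k' - 1"] ok'(1) k'
      unfolding stanley_rows_def by (metis diff_less le0 less_numeral_extra(1) order_trans)
    then have fin: "finite (fst ` Q)" "finite (snd ` Q)" and ne: "fst ` Q \<noteq> {}" "snd ` Q \<noteq> {}"
      using k' unfolding Q fst_row_cells[OF ok'(1)] snd_row_cells[OF ok'(1)] by auto
    have "s 0 = Min (fst ` Q) + fst v"
      using Min_fst_row_cells[OF ok] fin ne
      by (simp add: P[symmetric] PQ fst_translate Min_add_commute)
    moreover have "0 = Min (snd ` Q) + snd v"
      using Min_snd_row_cells[OF ok] fin ne
      by (simp add: P[symmetric] PQ snd_translate Min_add_commute)
    ultimately show ?thesis
      using Min_fst_row_cells[OF ok'(1)] Min_snd_row_cells[OF ok'(1)] ok'(2) Q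
      by (simp add: prod_eq_iff)
  qed
  define Q where "Q = row_cells k (\<lambda>j. s j - s 0) (\<lambda>j. e j - s 0)"
  have "stanley_rows k (\<lambda>j. s j - s 0) (\<lambda>j. e j - s 0)"
    using ok by (auto simp: stanley_rows_def)
  then have Q: "Q \<in> stanley_polyominoes"
    unfolding stanley_polyominoes_def Q_def by force
  have "P = translate (s 0, 0) Q"
  proof (rule set_eqI)
    fix c
    have "c \<in> translate (s 0, 0) Q \<longleftrightarrow> (fst c - s 0, snd c) \<in> Q"
      by (force simp: translate_def image_iff)
    also have "\<dots> \<longleftrightarrow> c \<in> P"
      by (cases c) (auto simp: Q_def P row_cells_def)
    finally show "c \<in> P \<longleftrightarrow> c \<in> translate (s 0, 0) Q" by simp
  qed
  with Q show ?thesis using v inv by metis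
qed


section \<open>The generating function\<close>

text \<open>The identity takes place in \<open>'a fps\<close>, power series in \<open>z\<close> (\<open>fps_X\<close>) over a field \<open>'a\<close>
  containing \<open>x\<close>, \<open>y\<close>, \<open>p\<close>, \<open>q\<close> with \<open>p\<close> and \<open>q\<close> nonzero, since negative powers of \<open>p\<close> occur on
  the right-hand side. The identity in indeterminates is the case of the field of fractions
  \<open>int poly poly poly poly fract\<close> and its four generators. Infinite sums are taken in the
  \<open>z\<close>-adic topology, which is the library's topology on \<open>'a fps\<close>.\<close>

definition weight ::
  "'a::field fps \<Rightarrow> 'a fps \<Rightarrow> 'a fps \<Rightarrow> 'a fps \<Rightarrow> 'a fps \<Rightarrow> (int \<times> int) set \<Rightarrow> 'a fps" where
  "weight x y z p q P = x ^ col_of P * y ^ row_of P * z ^ area_of P * p ^ edgint_of P * q ^ point_of P"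

definition F_gf :: "'a::field fps \<Rightarrow> 'a fps \<Rightarrow> 'a fps \<Rightarrow> 'a fps \<Rightarrow> 'a fps \<Rightarrow> 'a fps" where
  "F_gf x y z p q = (\<Sum>\<^sub>\<infinity>P\<in>stanley_polyominoes. weight x y z p q P)"

definition qpoch :: "'a::field fps \<Rightarrow> 'a fps \<Rightarrow> nat \<Rightarrow> 'a fps" where
  "qpoch a b k = (\<Prod>j<k. 1 - a * b ^ j)"

text \<open>All denominators below other than \<open>p ^ n\<close> and \<open>q ^ n\<close> have constant coefficient \<open>1\<close> or \<open>-1\<close>
  as power series in \<open>z\<close>, and the exponents divided by 2 are even.\<close>

definition Delta ::
  "'a::field fps \<Rightarrow> 'a fps \<Rightarrow> 'a fps \<Rightarrow> 'a fps \<Rightarrow> nat \<Rightarrow> 'a fps" where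
  "Delta x z p q l =
     1 / ((\<Prod>i<l. 1 - x * z * (z * p * q) ^ i) * (\<Prod>i<l. (z * p * q) ^ i * z * q * p - 1))"

definition G_term ::
  "'a::field fps \<Rightarrow> 'a fps \<Rightarrow> 'a fps \<Rightarrow> 'a fps \<Rightarrow> 'a fps \<Rightarrow> nat \<Rightarrow> 'a fps" where
  "G_term x y z p q l =
     (x ^ (l + 2) * y ^ (l + 2) * (p * q) ^ (l * (l + 3) div 2) * (p - 1)
          * z ^ ((l + 3) * (l + 2) div 2)
        - y ^ (l + 1) * x ^ (l + 1) * z ^ ((l + 2) * (l + 1) div 2)
          * (p * q) ^ (l * (l + 1) div 2) * p)
     / (p ^ (2 * l + 1) * q ^ l * (x * z * (z * p * q) ^ l - 1))
     * Delta x z p q l"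

definition H_term ::
  "'a::field fps \<Rightarrow> 'a fps \<Rightarrow> 'a fps \<Rightarrow> 'a fps \<Rightarrow> 'a fps \<Rightarrow> nat \<Rightarrow> 'a fps" where
  "H_term x y z p q l =
     ((- ((p * q) ^ (l * (l + 3) div 2) * z ^ ((l + 4) * (l + 1) div 2))
        + z ^ ((l + 6) * (l + 1) div 2) * q * (p - 1) * (p * q) ^ (l * (l + 5) div 2))
       * x ^ (l + 1) * y ^ (l + 1))
     / (p ^ (2 * l) * q ^ l * (x * z * (z * p * q) ^ l - 1) * ((z * p * q) ^ l * z * q * p - 1))
     * Delta x z p q l"

definition G_gf :: "'a::field fps \<Rightarrow> 'a fps \<Rightarrow> 'a fps \<Rightarrow> 'a fps \<Rightarrow> 'a fps \<Rightarrow> 'a fps" where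
  "G_gf x y z p q = (\<Sum>l. G_term x y z p q l)"

definition H_gf :: "'a::field fps \<Rightarrow> 'a fps \<Rightarrow> 'a fps \<Rightarrow> 'a fps \<Rightarrow> 'a fps \<Rightarrow> 'a fps" where
  "H_gf x y z p q = (\<Sum>l. H_term x y z p q l)"

end

theory Submission
  imports Defs
begin

text \<open>Let \<open>F t\<close> be the generating function in which \<open>t\<close> additionally marks the length of the
  bottom row. Lengthening the bottom row by one cell, or putting a new bottom row below a
  polyomino, expresses \<open>F t\<close> linearly in \<open>1\<close>, \<open>F 1\<close> and \<open>F (z p q t)\<close>: an overlap of \<open>v \<ge> 2\<close> cells
  creates \<open>v - 1\<close> interior points and \<open>v - 2\<close> internal edges, so summing over \<open>v\<close> gives a geometric
  series of ratio \<open>z p q t\<close>, and \<open>v = 1\<close> needs a correction, the source of the factors \<open>p - 1\<close>.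
  Iterating at \<open>t = 1, z p q, (z p q)\<^sup>2, \<dots>\<close> converges \<open>z\<close>-adically, and solving the resulting linear
  equation for \<open>F 1\<close> gives the quotient.\<close>

unbundle no vec_syntax and fps_syntax

section \<open>Sums of power series\<close>

text \<open>Cutting off at \<open>n \<le> N\<close> keeps coefficient \<open>N\<close> finite. When
  \<open>fps_X ^ n\<close> divides \<open>f n\<close>, the omitted terms vanish there, so this is
  the z-adic limit of the partial sums.\<close>

definition zsum :: "(nat \<Rightarrow> 'a::comm_ring_1 fps) \<Rightarrow> 'a fps" where
  "zsum f = Abs_fps (\<lambda>N. \<Sum>n\<le>N. f n $ N)"

lemma fps_X_power_dvd_nth:
  fixes f :: "'a::comm_ring_1 fps"
  assumes "fps_X ^ n dvd f" "i < n"
  shows "f $ i = 0"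
  using assms by (auto simp: dvd_def fps_X_power_mult_nth)

text \<open>Any larger cut-off gives the same coefficient, so products and shifted sums can be
  compared over a common range.\<close>

lemma zsum_nth:
  assumes "\<And>n. fps_X ^ n dvd f n" "N \<le> M"
  shows "zsum f $ N = (\<Sum>n\<le>M. f n $ N)"
  unfolding zsum_def fps_nth_Abs_fps
proof (rule sum.mono_neutral_left)
  show "\<forall>n\<in>{..M} - {..N}. f n $ N = 0"
    using fps_X_power_dvd_nth[OF assms(1)] by (auto simp: not_le)
qed (use assms(2) in auto)

lemma zsum_add: "zsum (\<lambda>n. f n + g n) = zsum f + zsum g"
  by (simp add: zsum_def fps_eq_iff sum.distrib)

lemma zsum_mult_left:
  assumes "\<And>n. fps_X ^ n dvd f n"
  shows "zsum (\<lambda>n. c * f n) = c * zsum f"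
proof (rule fps_ext)
  fix N
  have "(c * zsum f) $ N = (\<Sum>i=0..N. c $ i * (\<Sum>n\<le>N. f n $ (N - i)))"
    unfolding fps_mult_nth by (intro sum.cong refl) (metis assms diff_le_self zsum_nth)
  also have "\<dots> = (\<Sum>n\<le>N. \<Sum>i=0..N. c $ i * f n $ (N - i))"
    unfolding sum_distrib_left by (rule sum.swap)
  finally show "zsum (\<lambda>n. c * f n) $ N = (c * zsum f) $ N"
    by (simp add: zsum_def fps_mult_nth)
qed

lemma zsum_Suc:
  assumes "\<And>n. fps_X ^ n dvd f n"
  shows "zsum f = f 0 + zsum (\<lambda>n. f (Suc n))"
proof (rule fps_ext)
  fix N
  have "zsum f $ N = (\<Sum>n\<le>Suc N. f n $ N)"
    using zsum_nth[of f N "Suc N"] assms by simp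
  then show "zsum f $ N = (f 0 + zsum (\<lambda>n. f (Suc n))) $ N"
    by (simp add: zsum_def sum.atMost_Suc_shift del: sum.atMost_Suc)
qed

lemma sums_zsum:
  fixes f :: "nat \<Rightarrow> 'a::comm_ring_1 fps"
  assumes "\<And>n. fps_X ^ n dvd f n"
  shows "f sums zsum f"
  unfolding sums_def_le tendsto_fps_iff eventually_sequentially
  using zsum_nth[OF assms] by (metis fps_sum_nth)

text \<open>\<open>f m\<close> and \<open>g m\<close> stand for the generating functions of the polyominoes whose bottom row has length
  \<open>m\<close> and more than \<open>m\<close>, respectively. The factor \<open>p ^ (m - 2)\<close> relies on truncated subtraction:
  for \<open>m = 1\<close> it breaks the geometric pattern, whence the summand with \<open>p - 1\<close>.\<close>

lemma functional_equation:
  fixes x y z p q t u \<Phi> :: "'a::comm_ring_1 fps" and f g :: "nat \<Rightarrow> 'a fps"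
  assumes z: "z = fps_X"
    and f_dvd: "\<And>m. fps_X ^ m dvd f m"
    and f_0: "f 0 = 0" and f_1: "f 1 = x * y * z"
    and f_Suc: "\<And>m. 1 \<le> m \<Longrightarrow>
        f (Suc m) = x * z * f m + x * y * z ^ Suc m * (p ^ (m - 2) * q ^ (m - 1)) * g m"
    and g_0: "g 0 = \<Phi>" and g_Suc: "\<And>m. g m = f (Suc m) + g (Suc m)"
    and u: "u = z * p * q * t"
  shows "p\<^sup>2 * q * (1 - u) * (1 - x * z * t) * zsum (\<lambda>m. f m * t ^ m)
      = x * y * z * t * (p\<^sup>2 * q * (1 - u) + u * \<Phi> - zsum (\<lambda>m. f m * u ^ m)
          + (p - 1) * u * (1 - u) * (\<Phi> - x * y * z))"
proof -
  define F where "F t = zsum (\<lambda>m. f m * t ^ m)" for t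
  define S where "S = zsum (\<lambda>m. u ^ Suc m * g (Suc m))"
  have F_Suc: "F s = zsum (\<lambda>m. f (Suc m) * s ^ Suc m)" for s
    unfolding F_def using zsum_Suc[of "\<lambda>m. f m * s ^ m"] f_dvd f_0 by (simp add: dvd_mult2)
  have u_dvd: "fps_X ^ m dvd u ^ m" for m
    unfolding u z by (simp add: power_mult_distrib mult.assoc)
  have fs_dvd: "fps_X ^ m dvd f (Suc m) * s" for m s
    using f_dvd[of "Suc m"] by (metis dvd_mult2 power_Suc dvd_mult_right)
  have us_dvd: "fps_X ^ m dvd u ^ Suc m * s" for m s
    using u_dvd[of "Suc m"] by (metis dvd_mult2 power_Suc dvd_mult_right)
  \<comment> \<open>Since \<open>g (Suc m) = g m - f (Suc m)\<close>, the series \<open>S\<close>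
    satisfies a linear equation; this is where the factor \<open>1 - u\<close> comes from.\<close>
  have "S = zsum (\<lambda>m. u * (u ^ m * g m) + (- 1) * (f (Suc m) * u ^ Suc m))"
    unfolding S_def
    by (rule arg_cong[of _ _ zsum], rule ext, subst (2) g_Suc) (simp add: algebra_simps)
  also have "\<dots> = u * zsum (\<lambda>m. u ^ m * g m) + (- 1) * F u"
    unfolding zsum_add F_Suc using u_dvd fs_dvd by (simp only: zsum_mult_left dvd_mult2)
  also have "zsum (\<lambda>m. u ^ m * g m) = \<Phi> + S"
    using zsum_Suc[of "\<lambda>m. u ^ m * g m"] u_dvd by (simp add: S_def g_0 dvd_mult2)
  finally have S: "(1 - u) * S = u * \<Phi> - F u"
    by (simp add: algebra_simps)
  \<comment> \<open>The contribution of the last summand of \<open>f_Suc\<close> to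
    \<open>f (Suc (Suc m)) * t ^ Suc (Suc m)\<close>, with \<open>x * y * z * t\<close> taken
    out.\<close>
  define e where "e = (\<lambda>m. z ^ Suc m * (t ^ Suc m * (p ^ (m - 1) * q ^ m * g (Suc m))))"
  have e_dvd: "fps_X ^ m dvd e m" for m
    unfolding e_def z by (simp add: dvd_mult2 dvd_mult)
  have "F t = x * y * z * t + zsum (\<lambda>m. f (Suc (Suc m)) * t ^ Suc (Suc m))"
    unfolding F_Suc using zsum_Suc[of "\<lambda>m. f (Suc m) * t ^ Suc m"] fs_dvd f_1 by simp
  also have "zsum (\<lambda>m. f (Suc (Suc m)) * t ^ Suc (Suc m))
      = zsum (\<lambda>m. x * z * t * (f (Suc m) * t ^ Suc m) + x * y * z * t * e m)"
    by (rule arg_cong[of _ _ zsum]) (simp add: fun_eq_iff f_Suc e_def algebra_simps)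
  also have "\<dots> = x * z * t * F t + x * y * z * t * zsum e"
    unfolding zsum_add F_Suc using e_dvd fs_dvd by (simp only: zsum_mult_left)
  finally have F: "(1 - x * z * t) * F t = x * y * z * t * (1 + zsum e)"
    by (simp add: algebra_simps)
  \<comment> \<open>From index 1 on, the factor \<open>p\<^sup>2 * q\<close> completes the powers of
    \<open>u\<close>. At index 0 truncation gives \<open>p * u * g 1\<close> instead of
    \<open>u * g 1\<close>; the excess is the correction with \<open>p - 1\<close>.\<close>
  have e_Suc: "p\<^sup>2 * q * e (Suc m) = u ^ Suc (Suc m) * g (Suc (Suc m))" for m
    unfolding e_def u by (simp add: power_mult_distrib power2_eq_square algebra_simps)
  have "p\<^sup>2 * q * zsum e = p\<^sup>2 * q * e 0 + zsum (\<lambda>m. p\<^sup>2 * q * e (Suc m))"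
    using zsum_mult_left[of e "p\<^sup>2 * q"] zsum_Suc[of "\<lambda>m. p\<^sup>2 * q * e m"] e_dvd by simp
  also have "\<dots> = (p - 1) * u * g 1 + S"
    unfolding S_def e_Suc zsum_Suc[of "\<lambda>m. u ^ Suc m * g (Suc m)", OF us_dvd]
    by (simp add: e_def u power2_eq_square algebra_simps)
  finally have e: "p\<^sup>2 * q * zsum e = (p - 1) * u * (\<Phi> - x * y * z) + S"
    using g_Suc[of 0] f_1 g_0 by (simp add: algebra_simps)
  have "p\<^sup>2 * q * (1 - u) * (1 - x * z * t) * F t = p\<^sup>2 * q * (1 - u) * ((1 - x * z * t) * F t)"
    by (simp only: mult.assoc)
  also have "\<dots> = x * y * z * t * (p\<^sup>2 * q * (1 - u) + (1 - u) * (p\<^sup>2 * q * zsum e))"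
    unfolding F by (simp add: algebra_simps)
  also have "(1 - u) * (p\<^sup>2 * q * zsum e) = (p - 1) * u * (1 - u) * (\<Phi> - x * y * z) + (1 - u) * S"
    unfolding e by (simp add: algebra_simps)
  finally show ?thesis unfolding S F_def by (simp add: algebra_simps)
qed

lemma fps_eq_divideI: "D $ 0 \<noteq> 0 \<Longrightarrow> a * D = b \<Longrightarrow> a = b / D" for a b D :: "'a::field fps"
  by (metis fps_divide_unit inverse_mult_eq_1 mult.assoc mult.commute mult_1_right)

lemma fps_divide_mult_cancel: "D $ 0 \<noteq> 0 \<Longrightarrow> b / D * D = b" for b D :: "'a::field fps"
  by (simp add: fps_divide_unit mult.assoc inverse_mult_eq_1)

text \<open>Carries order estimates from terms with cleared denominators back to the summands of G
  and H.\<close>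

lemma fps_dvd_cancel_unit:
  fixes a b D :: "'a::field fps"
  assumes "a * D = b" "D $ 0 \<noteq> 0" "c dvd b"
  shows "c dvd a"
  using assms by (metis dvd_mult_unit_iff fps_is_unit_iff)

section \<open>Iterating the functional equation\<close>

text \<open>\<open>iter_coeff l\<close> is the product of the coefficients of \<open>F (z p q t)\<close> in the functional
  equation at \<open>t = (z p q) ^ i\<close>, \<open>i < l\<close>.\<close>

definition iter_coeff :: "'a::field fps \<Rightarrow> 'a fps \<Rightarrow> 'a fps \<Rightarrow> 'a fps \<Rightarrow> 'a fps \<Rightarrow> nat \<Rightarrow> 'a fps" where
  "iter_coeff x y z p q l = (x * y * z) ^ l * (z * p * q) ^ (\<Sum>i<l. i) * inverse (p ^ (2 * l) * q ^ l)
     * Delta x z p q l"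

lemma two_sum_lessThan: "2 * (\<Sum>i<l. i) + l = l * (l::nat)"
  by (induction l) auto

text \<open>In terms of \<open>T\<close>, the exponent of \<open>z * p * q\<close> in
  \<open>iter_coeff\<close>, the halved exponents are linear, so the power laws can compare
  monomials.\<close>

lemma half_exponents:
  fixes l :: nat
  defines "T \<equiv> \<Sum>i<l. i"
  shows "l * (l + 1) div 2 = T + l" "l * (l + 3) div 2 = T + 2 * l" "l * (l + 5) div 2 = T + 3 * l"
    "(l + 2) * (l + 1) div 2 = T + 2 * l + 1" "(l + 3) * (l + 2) div 2 = T + 3 * l + 3"
    "(l + 4) * (l + 1) div 2 = T + 3 * l + 2" "(l + 6) * (l + 1) div 2 = T + 4 * l + 3"
  using two_sum_lessThan[of l] unfolding T_def by (simp_all add: algebra_simps)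

section \<open>Iteration for nonzero constants p and q\<close>

context
  fixes p0 q0 :: "'a::field" and x y z p q :: "'a fps"
  assumes p0: "p0 \<noteq> 0" and q0: "q0 \<noteq> 0"
    and z: "z = fps_X" and p: "p = fps_const p0" and q: "q = fps_const q0"
begin

lemma unit_1_minus_xz: "(1 - x * z * s) $ 0 \<noteq> 0"
  and unit_1_minus_zpq: "(1 - z * p * q * s) $ 0 \<noteq> 0"
  by (simp_all add: z)

lemma unit_p_power_q_power: "(p ^ m * q ^ n) $ 0 \<noteq> 0"
  using p0 q0 by (simp add: p q fps_const_power)

lemma unit_Delta_denominator: "((\<Prod>i<l. 1 - x * z * (z * p * q) ^ i) * (\<Prod>i<l. (z * p * q) ^ i * z * q * p - 1)) $ 0 \<noteq> 0"
  by (induction l) (auto simp: z)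

lemma unit_equation_denominator:
  "(p\<^sup>2 * q * (1 - z * p * q * t) * (1 - x * z * t)) $ 0 \<noteq> 0"
  using unit_1_minus_xz[of t] unit_1_minus_zpq[of t] unit_p_power_q_power[of 2 1] by simp

text \<open>The second product in \<open>Delta\<close> has the factors of the Pochhammer symbol with
  opposite signs, whence \<open>(-1) ^ l\<close>.\<close>

lemma Delta_eq_qpoch:
  "Delta x z p q l = (-1) ^ l / (qpoch (x * z) (z * p * q) l * qpoch (z * p * q) (z * p * q) l)"
proof (rule fps_eq_divideI)
  show "(qpoch (x * z) (z * p * q) l * qpoch (z * p * q) (z * p * q) l) $ 0 \<noteq> 0"
    unfolding qpoch_def by (induction l) (auto simp: z)
  have "qpoch (z * p * q) (z * p * q) l = (-1) ^ l * (\<Prod>i<l. (z * p * q) ^ i * z * q * p - 1)"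
    unfolding qpoch_def by (induction l) (simp_all add: algebra_simps)
  then have "Delta x z p q l * (qpoch (x * z) (z * p * q) l * qpoch (z * p * q) (z * p * q) l)
    = (-1) ^ l * (Delta x z p q l
        * ((\<Prod>i<l. 1 - x * z * (z * p * q) ^ i) * (\<Prod>i<l. (z * p * q) ^ i * z * q * p - 1)))"
    by (simp add: qpoch_def mult_ac)
  also have "\<dots> = (-1) ^ l"
    unfolding Delta_def fps_divide_mult_cancel[OF unit_Delta_denominator] by simp
  finally show "Delta x z p q l * (qpoch (x * z) (z * p * q) l * qpoch (z * p * q) (z * p * q) l)
    = (-1) ^ l" .
qed

lemma iter_coeff_0: "iter_coeff x y z p q 0 = 1"
  by (simp add: iter_coeff_def Delta_def)

lemma Delta_Suc: "Delta x z p q (Suc l) * ((1 - x * z * (z * p * q) ^ l) * ((z * p * q) ^ Suc l - 1)) = Delta x z p q l"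
proof -
  let ?A = "\<lambda>l. (\<Prod>i<l. 1 - x * z * (z * p * q) ^ i) * (\<Prod>i<l. (z * p * q) ^ i * z * q * p - 1)"
  have "Delta x z p q (Suc l) * ((1 - x * z * (z * p * q) ^ l) * ((z * p * q) ^ Suc l - 1)) * ?A l
    = 1 / ?A (Suc l) * ?A (Suc l)"
    unfolding Delta_def by (simp add: algebra_simps)
  also have "\<dots> = 1"
    by (rule fps_divide_mult_cancel[OF unit_Delta_denominator])
  finally show ?thesis
    unfolding Delta_def by (rule fps_eq_divideI[OF unit_Delta_denominator])
qed

text \<open>The coefficient of \<open>F (z p q t)\<close> in the functional equation is negative;
  its sign is supplied by the new factor of the second product in \<open>Delta\<close>.\<close>

lemma iter_coeff_Suc:
  defines "t \<equiv> \<lambda>l. (z * p * q) ^ l"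
  shows "iter_coeff x y z p q (Suc l) * (p\<^sup>2 * q * (1 - t (Suc l)) * (1 - x * z * t l))
     = - iter_coeff x y z p q l * (x * y * z * t l)"
proof -
  have *: "inverse (p ^ (2 * Suc l) * q ^ Suc l) * (p\<^sup>2 * q) = inverse (p ^ (2 * l) * q ^ l)"
    using p0 q0 by (simp add: p q fps_const_inverse fps_const_power power2_eq_square field_simps)
  show ?thesis
    unfolding iter_coeff_def t_def Delta_Suc[symmetric, of l] *[symmetric]
    by (simp add: power_add power_mult_distrib algebra_simps)
qed

lemma inverse_p_power_q_power: "inverse (p ^ m * q ^ n) * (p ^ m * q ^ n) = 1"
  by (rule inverse_mult_eq_1[OF unit_p_power_q_power])

text \<open>The last factor on the right is the part of the functional equation at
  \<open>t l\<close> that contains neither \<open>F 1\<close> nor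
  \<open>F (z p q t)\<close>.\<close>

lemma G_term_eq:
  defines "t \<equiv> \<lambda>l. (z * p * q) ^ l"
  shows "G_term x y z p q l * (p\<^sup>2 * q * (1 - t (Suc l)) * (1 - x * z * t l)) = iter_coeff x y z p q l * (x * y * z * t l)
    * (p\<^sup>2 * q * (1 - t (Suc l)) - (p - 1) * t (Suc l) * (1 - t (Suc l)) * (x * y * z))"
proof -
  define N where "N = x ^ (l + 2) * y ^ (l + 2) * (p * q) ^ (l * (l + 3) div 2) * (p - 1)
          * z ^ ((l + 3) * (l + 2) div 2)
        - y ^ (l + 1) * x ^ (l + 1) * z ^ ((l + 2) * (l + 1) div 2)
          * (p * q) ^ (l * (l + 1) div 2) * p"
  define D where "D = p ^ (2 * l + 1) * q ^ l * (x * z * t l - 1)"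
  define P where "P = p ^ (2 * l) * q ^ l"
  define R where "R = p * q * (1 - t (Suc l)) * Delta x z p q l"
  have P: "inverse P * P = 1" unfolding P_def by (rule inverse_p_power_q_power)
  have "D $ 0 \<noteq> 0"
    using unit_p_power_q_power[of "2 * l + 1" l] unfolding D_def by (simp add: z)
  then have ND: "N / D * D = N" by (rule fps_divide_mult_cancel)
  \<comment> \<open>The sign comes from \<open>x * z * t l - 1\<close>. Only \<open>p * q\<close> is
    left of \<open>p\<^sup>2 * q\<close>, because \<open>D\<close> has the odd power
    \<open>p ^ (2 * l + 1)\<close>.\<close>
  have N: "- N * (p * q) = (x * y * z) ^ Suc l * (z * p * q) ^ ((\<Sum>i<l. i) + l) * (p\<^sup>2 * q - (p - 1) * t (Suc l) * (x * y * z))"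
    unfolding N_def half_exponents t_def
    by (simp add: power_add power_mult_distrib power2_eq_square power3_eq_cube mult_2 mult_2_right numeral_3_eq_3 algebra_simps)
  have "G_term x y z p q l * (p\<^sup>2 * q * (1 - t (Suc l)) * (1 - x * z * t l))
     = inverse P * P * (N / D) * Delta x z p q l * (p\<^sup>2 * q * (1 - t (Suc l)) * (1 - x * z * t l))"
    unfolding G_term_def N_def D_def t_def P by simp
  also have "\<dots> = - (inverse P * (N / D * D) * R)"
    unfolding D_def P_def R_def by (simp add: power2_eq_square algebra_simps)
  also have "\<dots> = inverse P * Delta x z p q l * (1 - t (Suc l)) * (- N * (p * q))"
    unfolding ND R_def by (simp add: algebra_simps)
  finally show ?thesis
    unfolding N iter_coeff_def P_def t_def by (simp add: power_add algebra_simps)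
qed

text \<open>Here the last factor is the coefficient of \<open>F 1\<close> in the functional
  equation; the minus sign prepares moving these terms to the left-hand side.\<close>

lemma H_term_eq:
  defines "t \<equiv> \<lambda>l. (z * p * q) ^ l"
  shows "H_term x y z p q l * (p\<^sup>2 * q * (1 - t (Suc l)) * (1 - x * z * t l)) = - iter_coeff x y z p q l * (x * y * z * t l)
    * (t (Suc l) + (p - 1) * t (Suc l) * (1 - t (Suc l)))"
proof -
  define N where "N = (- ((p * q) ^ (l * (l + 3) div 2) * z ^ ((l + 4) * (l + 1) div 2))
        + z ^ ((l + 6) * (l + 1) div 2) * q * (p - 1) * (p * q) ^ (l * (l + 5) div 2))
       * x ^ (l + 1) * y ^ (l + 1)"
  define D where "D = p ^ (2 * l) * q ^ l * (x * z * t l - 1) * (t l * z * q * p - 1)"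
  define P where "P = p ^ (2 * l) * q ^ l"
  have P: "inverse P * P = 1" unfolding P_def by (rule inverse_p_power_q_power)
  have "D $ 0 \<noteq> 0"
    using unit_p_power_q_power[of "2 * l" l] unfolding D_def by (simp add: z)
  then have ND: "N / D * D = N" by (rule fps_divide_mult_cancel)
  have N: "N * (p\<^sup>2 * q) = - ((x * y * z) ^ Suc l * (z * p * q) ^ ((\<Sum>i<l. i) + l) * (t (Suc l) + (p - 1) * t (Suc l) * (1 - t (Suc l))))"
    unfolding N_def half_exponents t_def
    by (simp add: power_add power_mult_distrib power2_eq_square power3_eq_cube mult_2 mult_2_right numeral_3_eq_3
        power_mult power4_eq_xxxx algebra_simps)
  have "H_term x y z p q l * (p\<^sup>2 * q * (1 - t (Suc l)) * (1 - x * z * t l))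
     = inverse P * P * (N / D) * Delta x z p q l * (p\<^sup>2 * q * (1 - t (Suc l)) * (1 - x * z * t l))"
    unfolding H_term_def N_def D_def t_def P by simp
  also have "\<dots> = inverse P * (N / D * D) * Delta x z p q l * (p\<^sup>2 * q)"
    unfolding D_def P_def t_def by (simp add: algebra_simps)
  also have "\<dots> = inverse P * Delta x z p q l * (N * (p\<^sup>2 * q))"
    unfolding ND by (simp add: algebra_simps)
  finally show ?thesis
    unfolding N iter_coeff_def P_def t_def by (simp add: power_add algebra_simps)
qed

lemma iter_coeff_dvd: "fps_X ^ l dvd iter_coeff x y z p q l"
  unfolding iter_coeff_def z by (simp add: power_mult_distrib mult.assoc dvd_mult)

lemma iter_coeff_factor_dvd: "fps_X ^ Suc l dvd iter_coeff x y z p q l * (x * y * z * s)"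
proof -
  have "fps_X ^ l * fps_X dvd iter_coeff x y z p q l * (x * y * z * s)"
    by (intro mult_dvd_mono iter_coeff_dvd) (simp add: z)
  then show ?thesis by (simp add: mult.commute)
qed

lemma G_term_dvd: "fps_X ^ Suc l dvd G_term x y z p q l"
  by (rule fps_dvd_cancel_unit[OF G_term_eq]) (use unit_equation_denominator[of "(z * p * q) ^ l"] iter_coeff_factor_dvd in
      \<open>auto simp: mult.assoc intro: dvd_mult2\<close>)

text \<open>The order \<open>Suc l\<close>, one more than convergence asks for, makes the constant
  coefficient of \<open>H_gf\<close> zero, so \<open>1 + H_gf\<close> is a unit.\<close>

lemma H_term_dvd: "fps_X ^ Suc l dvd H_term x y z p q l"
  by (rule fps_dvd_cancel_unit[OF H_term_eq]) (use unit_equation_denominator[of "(z * p * q) ^ l"] iter_coeff_factor_dvd in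
      \<open>auto simp: mult.assoc intro: dvd_mult2\<close>)

lemma G_term_dvd': "fps_X ^ l dvd G_term x y z p q l"
  and H_term_dvd': "fps_X ^ l dvd H_term x y z p q l"
  using G_term_dvd[of l] H_term_dvd[of l] by (auto intro: dvd_mult_right)

lemma G_gf_eq: "G_gf x y z p q = zsum (G_term x y z p q)"
  and H_gf_eq: "H_gf x y z p q = zsum (H_term x y z p q)"
  unfolding G_gf_def H_gf_def
  using sums_zsum[OF G_term_dvd'] sums_zsum[OF H_term_dvd'] by (auto dest: sums_unique)

lemma unit_1_plus_H: "(1 + H_gf x y z p q) $ 0 \<noteq> 0"
  using fps_X_power_dvd_nth[OF H_term_dvd[of 0], of 0] by (simp add: H_gf_eq zsum_def)

text \<open>The iteration telescopes: it starts from \<open>g 0\<close>, which is \<open>F\<close>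
  at \<open>t = 1\<close>, collects the summands of G and H, and leaves a remainder of order at
  least \<open>L\<close> after \<open>L\<close> steps.\<close>

lemma G_eq_mult_H:
  fixes f g :: "nat \<Rightarrow> 'a fps"
  assumes f_dvd: "\<And>m. fps_X ^ m dvd f m"
    and f_0: "f 0 = 0" and f_1: "f 1 = x * y * z"
    and f_Suc: "\<And>m. 1 \<le> m \<Longrightarrow>
        f (Suc m) = x * z * f m + x * y * z ^ Suc m * (p ^ (m - 2) * q ^ (m - 1)) * g m"
    and g_Suc: "\<And>m. g m = f (Suc m) + g (Suc m)"
    and g_0: "g 0 = zsum f"
  shows "g 0 * (1 + H_gf x y z p q) = G_gf x y z p q"
proof -
  define t where "t l = (z * p * q) ^ l" for l
  define F where "F l = zsum (\<lambda>m. f m * t l ^ m)" for l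
  let ?E = "iter_coeff x y z p q" and ?G = "G_term x y z p q" and ?H = "H_term x y z p q"
  \<comment> \<open>This is the functional equation at \<open>t l\<close>, multiplied by
    \<open>?E l\<close>; it is checked after clearing the common denominator
    \<open>?D\<close>.\<close>
  have step: "?E l * F l = ?G l - g 0 * ?H l + ?E (Suc l) * F (Suc l)" for l
  proof -
    let ?D = "p\<^sup>2 * q * (1 - t (Suc l)) * (1 - x * z * t l)"
    have distrib: "(a - b * c + d * e) * D = a * D - b * (c * D) + d * D * e"
      for a b c d e D :: "'a fps"
      by (simp add: algebra_simps)
    have "?D * F l = x * y * z * t l * (p\<^sup>2 * q * (1 - t (Suc l)) + t (Suc l) * g 0 - F (Suc l)
          + (p - 1) * t (Suc l) * (1 - t (Suc l)) * (g 0 - x * y * z))"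
      unfolding F_def
      by (rule functional_equation[OF z f_dvd f_0 f_1 f_Suc refl g_Suc]) (simp_all add: t_def)
    then have "?E l * F l * ?D = ?E l * (x * y * z * t l)
        * (p\<^sup>2 * q * (1 - t (Suc l)) - (p - 1) * t (Suc l) * (1 - t (Suc l)) * (x * y * z))
      - g 0 * (- ?E l * (x * y * z * t l) * (t (Suc l) + (p - 1) * t (Suc l) * (1 - t (Suc l))))
      + - ?E l * (x * y * z * t l) * F (Suc l)"
      by (simp add: mult.assoc mult.commute[of "F l"]) (simp add: algebra_simps)
    also have "\<dots> = (?G l - g 0 * ?H l + ?E (Suc l) * F (Suc l)) * ?D"
      unfolding distrib t_def G_term_eq H_term_eq iter_coeff_Suc by (rule refl)
    finally have *: "?E l * F l * ?D = (?G l - g 0 * ?H l + ?E (Suc l) * F (Suc l)) * ?D" .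
    have "?D $ 0 \<noteq> 0"
      using unit_equation_denominator[of "t l"] unfolding t_def power_Suc .
    then have "?D \<noteq> 0" by (metis fps_zero_nth)
    then show ?thesis by (rule iffD1[OF mult_right_cancel *])
  qed
  have partial: "g 0 + g 0 * (\<Sum>l<L. ?H l) = (\<Sum>l<L. ?G l) + ?E L * F L" for L
  proof (induction L)
    case 0
    then show ?case by (simp add: iter_coeff_0 F_def t_def g_0)
  next
    case (Suc L)
    have "g 0 + g 0 * (\<Sum>l<Suc L. ?H l) = (\<Sum>l<L. ?G l) + ?E L * F L + g 0 * ?H L"
      unfolding Suc[symmetric] by (simp add: distrib_left)
    then show ?case unfolding step[of L] by simp
  qed
  have "zsum ?G = g 0 + zsum (\<lambda>l. g 0 * ?H l)"
  proof (rule fps_ext)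
    fix N
    \<comment> \<open>After \<open>Suc N\<close> steps the remainder no longer reaches coefficient
      \<open>N\<close>.\<close>
    have "(?E (Suc N) * F (Suc N)) $ N = 0"
      by (rule fps_X_power_dvd_nth[OF dvd_mult2[OF iter_coeff_dvd]]) simp
    moreover have "(g 0 + (\<Sum>l<Suc N. g 0 * ?H l)) $ N = ((\<Sum>l<Suc N. ?G l) + ?E (Suc N) * F (Suc N)) $ N"
      by (simp only: partial[of "Suc N"] sum_distrib_left[symmetric])
    ultimately show "zsum ?G $ N = (g 0 + zsum (\<lambda>l. g 0 * ?H l)) $ N"
      by (simp add: zsum_def fps_sum_nth lessThan_Suc_atMost del: sum.lessThan_Suc)
  qed
  then show ?thesis
    by (simp add: G_gf_eq H_gf_eq zsum_mult_left[OF H_term_dvd'] algebra_simps)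
qed

end

section \<open>Row codes of Stanley polyominoes\<close>

text \<open>A polyomino is encoded by the list, from the bottom row upwards, of the pairs of the length of
  a row and the length of its overlap with the next row (\<open>0\<close> for the top row).\<close>

primrec chain :: "(nat \<times> nat) list \<Rightarrow> bool" where
  "chain [] \<longleftrightarrow> False"
| "chain (r # L) \<longleftrightarrow>
    (if L = [] then 0 < fst r \<and> snd r = 0
     else 0 < snd r \<and> snd r < fst r \<and> snd r < fst (hd L) \<and> chain L)"

definition chain_area :: "(nat \<times> nat) list \<Rightarrow> nat" where
  "chain_area L = sum_list (map fst L)"

text \<open>The truncated subtractions give the right exponents for overlaps \<open>0\<close> and \<open>1\<close>, too.\<close>

definition chain_weight :: "'a::field \<Rightarrow> 'a \<Rightarrow> 'a \<Rightarrow> 'a \<Rightarrow> (nat \<times> nat) list \<Rightarrow> 'a" where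
  "chain_weight x y p q L = (\<Prod>(m, v)\<leftarrow>L. x ^ (m - v) * y * p ^ (v - 2) * q ^ (v - 1))"

lemma chain_not_Nil: "chain L \<Longrightarrow> L \<noteq> []"
  by auto

lemma chain_fst_pos: "chain L \<Longrightarrow> r \<in> set L \<Longrightarrow> 0 < fst r"
  by (induction L) (auto split: if_splits)

lemma chain_hd_pos: "chain L \<Longrightarrow> 0 < fst (hd L)"
  using chain_fst_pos chain_not_Nil by (metis hd_in_set)

lemma chain_snd_le: "chain L \<Longrightarrow> r \<in> set L \<Longrightarrow> snd r \<le> fst r"
  by (induction L) (auto split: if_splits)

lemma chain_hd_le_area: "chain L \<Longrightarrow> fst (hd L) \<le> chain_area L"
  by (cases L) (auto simp: chain_area_def)

text \<open>Rows are nonempty and overlaps fit into rows, so the area bounds the length of the list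
  and all its entries.\<close>

lemma finite_chains: "finite {L. chain L \<and> chain_area L = N}"
proof (rule finite_subset)
  have len: "length L \<le> chain_area L" if "\<forall>r\<in>set L. 0 < fst r" for L
    using that by (induction L) (auto simp: chain_area_def Suc_le_eq add_pos_nonneg)
  have el: "r \<in> set L \<Longrightarrow> fst r \<le> chain_area L" for L r
    unfolding chain_area_def by (rule member_le_sum_list) auto
  show "{L. chain L \<and> chain_area L = N} \<subseteq> {L. set L \<subseteq> {..N} \<times> {..N} \<and> length L \<le> N}"
  proof safe
    fix L a b assume "chain L" "(a, b) \<in> set L"
    then show "a \<le> chain_area L" "b \<le> chain_area L"
      using el[of "(a, b)" L] chain_snd_le[of L "(a, b)"] by auto
  qed (use len chain_fst_pos in blast)
  show "finite {L. set L \<subseteq> {..N} \<times> {..N} \<and> length L \<le> N}"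
    by (rule finite_lists_length_le) auto
qed

section \<open>Generating functions by the length of the bottom row\<close>

definition chains_bottom :: "nat \<Rightarrow> nat \<Rightarrow> (nat \<times> nat) list set" where
  "chains_bottom N m = {L. chain L \<and> chain_area L = N \<and> fst (hd L) = m}"

definition chains_bottom_gt :: "nat \<Rightarrow> nat \<Rightarrow> (nat \<times> nat) list set" where
  "chains_bottom_gt N m = {L. chain L \<and> chain_area L = N \<and> m < fst (hd L)}"

lemma finite_chains_bottom: "finite (chains_bottom N m)" and finite_chains_bottom_gt: "finite (chains_bottom_gt N m)"
  unfolding chains_bottom_def chains_bottom_gt_def by (rule finite_subset[OF _ finite_chains[of N]], blast)+

text \<open>\<open>bottom_gf\<close> and \<open>bottom_gt_gf\<close> are the \<open>f\<close> and
  \<open>g\<close> to which \<open>functional_equation\<close> is applied.\<close>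

definition bottom_gf :: "'a::field \<Rightarrow> 'a \<Rightarrow> 'a \<Rightarrow> 'a \<Rightarrow> nat \<Rightarrow> 'a fps" where
  "bottom_gf x y p q m = Abs_fps (\<lambda>N. sum (chain_weight x y p q) (chains_bottom N m))"

definition bottom_gt_gf :: "'a::field \<Rightarrow> 'a \<Rightarrow> 'a \<Rightarrow> 'a \<Rightarrow> nat \<Rightarrow> 'a fps" where
  "bottom_gt_gf x y p q m = Abs_fps (\<lambda>N. sum (chain_weight x y p q) (chains_bottom_gt N m))"

lemma chains_bottom_empty: "N < m \<Longrightarrow> chains_bottom N m = {}"
  unfolding chains_bottom_def using chain_hd_le_area by fastforce

lemma chains_bottom_gt_split: "chains_bottom_gt N m = chains_bottom N (Suc m) \<union> chains_bottom_gt N (Suc m)"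
  unfolding chains_bottom_def chains_bottom_gt_def by auto

lemma bottom_gt_gf_Suc: "bottom_gt_gf x y p q m = bottom_gf x y p q (Suc m) + bottom_gt_gf x y p q (Suc m)"
proof -
  have "sum (chain_weight x y p q) (chains_bottom_gt N m)
      = sum (chain_weight x y p q) (chains_bottom N (Suc m)) + sum (chain_weight x y p q) (chains_bottom_gt N (Suc m))" for N
    unfolding chains_bottom_gt_split[of N m]
    by (rule sum.union_disjoint) (auto simp: finite_chains_bottom finite_chains_bottom_gt, auto simp: chains_bottom_def chains_bottom_gt_def)
  then show ?thesis by (simp add: bottom_gf_def bottom_gt_gf_def fps_eq_iff)
qed

lemma bottom_gf_dvd: "fps_X ^ m dvd bottom_gf x y p q m"
proof -
  have "bottom_gf x y p q m = fps_X ^ m * fps_shift m (bottom_gf x y p q m)"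
    by (rule fps_ext) (simp add: bottom_gf_def fps_X_power_mult_nth chains_bottom_empty)
  then show ?thesis by (metis dvd_triv_left)
qed

lemma bottom_gf_0: "bottom_gf x y p q 0 = 0"
proof -
  have "chains_bottom N 0 = {}" for N
    using chain_hd_pos by (fastforce simp: chains_bottom_def)
  then show ?thesis by (simp add: bottom_gf_def fps_eq_iff)
qed

lemma bottom_gt_gf_0: "bottom_gt_gf x y p q 0 = zsum (bottom_gf x y p q)"
proof (rule fps_ext)
  fix N
  have "chains_bottom_gt N 0 = (\<Union>m\<le>N. chains_bottom N m)"
    using chain_hd_pos chain_hd_le_area by (auto simp: chains_bottom_def chains_bottom_gt_def)
  then have "sum (chain_weight x y p q) (chains_bottom_gt N 0)
      = (\<Sum>m\<le>N. sum (chain_weight x y p q) (chains_bottom N m))"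
    using finite_chains_bottom by (simp only:, intro sum.UNION_disjoint) (auto simp: chains_bottom_def)
  then show "bottom_gt_gf x y p q 0 $ N = zsum (bottom_gf x y p q) $ N"
    by (simp add: bottom_gt_gf_def bottom_gf_def zsum_def)
qed

text \<open>A second row would need an overlap strictly between 0 and 1.\<close>

lemma chains_bottom_1: "chains_bottom N 1 = (if N = 1 then {[(1, 0)]} else {})"
proof -
  have "chain L \<and> fst (hd L) = 1 \<longleftrightarrow> L = [(1, 0)]" for L
    by (cases L) (auto simp: prod_eq_iff)
  then have "chains_bottom N 1 = {L. L = [(1, 0)] \<and> chain_area L = N}"
    unfolding chains_bottom_def by blast
  moreover have "chain_area [(1, 0)] = 1"
    by (simp add: chain_area_def)
  ultimately show ?thesis
    by (metis (mono_tags, lifting) empty_Collect_eq singleton_conv Collect_cong)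
qed

lemma bottom_gf_1: "bottom_gf x y p q 1 = fps_const x * fps_const y * fps_X"
proof (rule fps_ext)
  fix N show "bottom_gf x y p q 1 $ N = (fps_const x * fps_const y * fps_X) $ N"
    unfolding bottom_gf_def fps_nth_Abs_fps chains_bottom_1
    by (simp add: chain_weight_def mult.assoc)
qed

section \<open>Recursion on the bottom row\<close>

abbreviation grow :: "(nat \<times> nat) list \<Rightarrow> (nat \<times> nat) list" where
  "grow L \<equiv> (Suc (fst (hd L)), snd (hd L)) # tl L"

text \<open>If the overlap is below \<open>m\<close> or there is no second row, the leftmost bottom
  cell can be removed, which undoes \<open>grow\<close>. An overlap of \<open>m\<close> forbids
  this, and the whole bottom row is removed instead.\<close>

lemma chains_bottom_Suc:
  assumes "1 \<le> m"
  shows "chains_bottom (Suc N) (Suc m) = grow ` chains_bottom N m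
    \<union> (if m \<le> N then (\<lambda>L. (Suc m, m) # L) ` chains_bottom_gt (N - m) m else {})" (is "?A = ?B \<union> ?C")
proof
  show "?A \<subseteq> ?B \<union> ?C"
  proof
    fix L assume L: "L \<in> ?A"
    then obtain v R where LR: "L = (Suc m, v) # R"
      by (cases L) (auto simp: chains_bottom_def)
    show "L \<in> ?B \<union> ?C"
    proof (cases "R \<noteq> [] \<and> v = m")
      case True
      then have "m \<le> N \<and> R \<in> chains_bottom_gt (N - m) m"
        using L by (auto simp: LR chains_bottom_def chains_bottom_gt_def chain_area_def)
      then show ?thesis using True LR by auto
    next
      case False
      then have "(m, v) # R \<in> chains_bottom N m"
        using L assms by (auto simp: LR chains_bottom_def chain_area_def split: if_splits)
      then have "grow ((m, v) # R) \<in> ?B" by (rule imageI)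
      then show ?thesis by (simp add: LR)
    qed
  qed
  have "grow L \<in> ?A" if "L \<in> chains_bottom N m" for L
    using that by (cases L) (auto simp: chains_bottom_def chain_area_def split: if_splits)
  moreover have "(Suc m, m) # L \<in> ?A" if "m \<le> N" "L \<in> chains_bottom_gt (N - m) m" for L
    using that assms by (auto simp: chains_bottom_def chains_bottom_gt_def chain_area_def)
  ultimately show "?B \<union> ?C \<subseteq> ?A" by auto
qed

text \<open>Growing keeps the overlap and adds a column, hence the factor \<open>x\<close>. A new
  row of \<open>Suc m\<close> cells with overlap \<open>m\<close> also adds one column.\<close>

lemma sum_chains_bottom_Suc:
  assumes "1 \<le> m"
  shows "sum (chain_weight x y p q) (chains_bottom (Suc N) (Suc m))
    = x * sum (chain_weight x y p q) (chains_bottom N m)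
    + (if m \<le> N then x * y * (p ^ (m - 2) * q ^ (m - 1)) * sum (chain_weight x y p q) (chains_bottom_gt (N - m) m) else 0)"
proof -
  let ?w = "chain_weight x y p q"
  have grow: "sum ?w (grow ` chains_bottom N m) = x * sum ?w (chains_bottom N m)"
  proof -
    have "inj_on grow (chains_bottom N m)"
      by (intro inj_onI) (auto simp: chains_bottom_def prod_eq_iff intro: list.expand)
    moreover have "?w (grow L) = x * ?w L" if "L \<in> chains_bottom N m" for L
    proof (cases L)
      case (Cons r R)
      then have "snd r \<le> fst r"
        using that chain_snd_le[of L r] by (auto simp: chains_bottom_def)
      then show ?thesis
        using Cons by (simp add: chain_weight_def Suc_diff_le case_prod_beta mult.assoc)
    qed (use that in \<open>auto simp: chains_bottom_def\<close>)
    ultimately show ?thesis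
      by (simp add: sum.reindex sum_distrib_left)
  qed
  have new: "sum ?w ((\<lambda>L. (Suc m, m) # L) ` A) = x * y * (p ^ (m - 2) * q ^ (m - 1)) * sum ?w A" for A
    by (simp add: sum.reindex sum_distrib_left chain_weight_def mult.assoc)
  \<comment> \<open>A grown code has bottom overlap below \<open>m\<close>: strictly so with several
    rows, and 0 with one row, where \<open>1 \<le> m\<close> enters.\<close>
  have "grow L \<noteq> (Suc m, m) # R" if "L \<in> chains_bottom N m" "R \<in> chains_bottom_gt (N - m) m" for L R
  proof (cases L)
    case (Cons r L')
    then show ?thesis
      using that assms by (auto simp: chains_bottom_def chains_bottom_gt_def split: if_splits)
  qed (use that in \<open>auto simp: chains_bottom_def\<close>)
  then show ?thesis
    unfolding chains_bottom_Suc[OF assms]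
    by (subst sum.union_disjoint) (auto simp: finite_chains_bottom finite_chains_bottom_gt grow new)
qed

lemma bottom_gf_Suc:
  assumes "1 \<le> m"
  shows "bottom_gf x y p q (Suc m) = fps_const x * fps_X * bottom_gf x y p q m
    + fps_const x * fps_const y * fps_X ^ Suc m
        * (fps_const p ^ (m - 2) * fps_const q ^ (m - 1)) * bottom_gt_gf x y p q m"
proof (rule fps_ext)
  fix N
  let ?c = "x * y * (p ^ (m - 2) * q ^ (m - 1))"
  have "(fps_const x * fps_X * bottom_gf x y p q m + fps_const x * fps_const y * fps_X ^ Suc m
        * (fps_const p ^ (m - 2) * fps_const q ^ (m - 1)) * bottom_gt_gf x y p q m)
    = fps_const x * (fps_X * bottom_gf x y p q m) + fps_const ?c * (fps_X ^ Suc m * bottom_gt_gf x y p q m)"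
    by (simp only: fps_const_mult[symmetric] fps_const_power mult.assoc mult.left_commute[of "fps_X ^ Suc m"])
  also have "\<dots> $ N = bottom_gf x y p q (Suc m) $ N"
  proof (cases N)
    case 0
    then show ?thesis by (simp add: bottom_gf_def chains_bottom_empty)
  next
    case (Suc M)
    have "(fps_X ^ Suc m * bottom_gt_gf x y p q m) $ Suc M = (if m \<le> M then bottom_gt_gf x y p q m $ (M - m) else 0)"
      by (simp only: fps_X_power_mult_nth) simp
    then show ?thesis
      by (simp add: Suc bottom_gf_def bottom_gt_gf_def sum_chains_bottom_Suc[OF assms] del: power_Suc)
  qed
  finally show "bottom_gf x y p q (Suc m) $ N = (fps_const x * fps_X * bottom_gf x y p q m
    + fps_const x * fps_const y * fps_X ^ Suc m
        * (fps_const p ^ (m - 2) * fps_const q ^ (m - 1)) * bottom_gt_gf x y p q m) $ N" ..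
qed

section \<open>The statistics of a Stanley polyomino\<close>

lemma mem_row_cells: "(a, b) \<in> row_cells k s e \<longleftrightarrow> 0 \<le> b \<and> b < int k \<and> s (nat b) \<le> a \<and> a \<le> e (nat b)"
  unfolding row_cells_def by (auto intro!: exI[of _ "nat b"])

text \<open>Only four cells have a given corner, so a count of 4 means that all of them are
  present.\<close>

lemma interior_points_iff:
  "(a, b) \<in> interior_points P \<longleftrightarrow> {a - 1, a} \<times> {b - 1, b} \<subseteq> P"
proof -
  have *: "{c \<in> P. (a, b) \<in> corners c} = P \<inter> {a - 1, a} \<times> {b - 1, b}"
    by (auto simp: corners_def)
  have card: "card ({a - 1, a} \<times> {b - 1, b}) = 4"
    by (simp add: card_cartesian_product)
  show ?thesis
    unfolding interior_points_def mem_Collect_eq *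
    using card card_subset_eq[of "{a - 1, a} \<times> {b - 1, b}" "P \<inter> {a - 1, a} \<times> {b - 1, b}"]
    by (metis Int_absorb1 Int_commute finite.emptyI finite.insertI finite_cartesian_product inf_le2 inf_le1)
qed

lemma stanley_rowsD:
  assumes "stanley_rows k s e" "Suc j < k"
  shows "s j < s (Suc j)" "s (Suc j) \<le> e j" "e j < e (Suc j)"
  using assms unfolding stanley_rows_def by (auto dest!: spec[of _ "Suc j"])

text \<open>A point between rows \<open>j\<close> and \<open>Suc j\<close> needs the cells on both
  its sides in both rows. As starts and ends increase, the start of the upper and the end of the
  lower row decide.\<close>

lemma interior_points_row_cells:
  assumes "stanley_rows k s e"
  shows "interior_points (row_cells k s e) = (\<lambda>(j, a). (a, int (Suc j))) ` (SIGMA j:{..<k-1}. {s (Suc j)<..e j})"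
proof (rule set_eqI, clarify)
  fix a b
  show "(a, b) \<in> interior_points (row_cells k s e)
    \<longleftrightarrow> (a, b) \<in> (\<lambda>(j, a). (a, int (Suc j))) ` (SIGMA j:{..<k-1}. {s (Suc j)<..e j})"
  proof (cases "1 \<le> b")
    case True
    define j where "j = nat (b - 1)"
    have b: "b = int (Suc j)" using True by (simp add: j_def)
    have "(a, b) \<in> interior_points (row_cells k s e) \<longleftrightarrow> Suc j < k \<and> s (Suc j) < a \<and> a \<le> e j"
      using stanley_rowsD[OF assms, of j] unfolding interior_points_iff
      by (auto simp: mem_row_cells b nat_add_distrib)
    then show ?thesis by (auto simp: b image_iff)
  next
    case False
    then have "(a, b - 1) \<notin> row_cells k s e" by (auto simp: mem_row_cells)
    then show ?thesis using False by (auto simp: interior_points_iff)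
  qed
qed

lemma inj_on_swap_Suc: "inj_on (\<lambda>(j, a). (a, int (Suc j))) A"
  by (auto simp: inj_on_def)

lemma point_of_row_cells:
  assumes "stanley_rows k s e"
  shows "point_of (row_cells k s e) = (\<Sum>j<k-1. nat (e j - s (Suc j)))"
  unfolding point_of_def interior_points_row_cells[OF assms] card_image[OF inj_on_swap_Suc]
  by simp

lemma edgint_of_row_cells:
  assumes "stanley_rows k s e"
  shows "edgint_of (row_cells k s e) = (\<Sum>j<k-1. nat (e j - s (Suc j) - 1))"
proof -
  have "{(a, b). (a, b) \<in> interior_points (row_cells k s e) \<and> (a + 1, b) \<in> interior_points (row_cells k s e)}
    = (\<lambda>(j, a). (a, int (Suc j))) ` (SIGMA j:{..<k-1}. {s (Suc j)<..e j - 1})"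
    unfolding interior_points_row_cells[OF assms] by (force simp: image_iff)
  then have "edgint_of (row_cells k s e) = card (SIGMA j:{..<k-1}. {s (Suc j)<..e j - 1})"
    unfolding edgint_of_def by (simp only: card_image[OF inj_on_swap_Suc])
  then show ?thesis by (simp add: algebra_simps)
qed

lemma area_of_row_cells: "area_of (row_cells k s e) = (\<Sum>j<k. nat (e j - s j + 1))"
proof -
  have "row_cells k s e = (\<lambda>(j, a). (a, int j)) ` (SIGMA j:{..<k}. {s j..e j})"
    unfolding row_cells_def by (force simp: image_iff)
  moreover have "inj_on (\<lambda>(j, a). (a, int j)) A" for A :: "(nat \<times> int) set"
    by (auto simp: inj_on_def)
  ultimately show ?thesis
    by (simp add: area_of_def card_image)
qed

section \<open>The bijection between codes and polyominoes\<close>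

definition row_start :: "(nat \<times> nat) list \<Rightarrow> nat \<Rightarrow> int" where
  "row_start L j = (\<Sum>i<j. int (fst (L ! i)) - int (snd (L ! i)))"

definition row_end :: "(nat \<times> nat) list \<Rightarrow> nat \<Rightarrow> int" where
  "row_end L j = row_start L j + int (fst (L ! j)) - 1"

definition chain_cells :: "(nat \<times> nat) list \<Rightarrow> (int \<times> int) set" where
  "chain_cells L = row_cells (length L) (row_start L) (row_end L)"

text \<open>Indexed form of the recursive definition, to be matched with
  \<open>stanley_rows\<close>.\<close>

lemma chain_iff_nth:
  "chain L \<longleftrightarrow> L \<noteq> [] \<and> (\<forall>j<length L. 0 < fst (L ! j)) \<and> snd (last L) = 0 \<and>
    (\<forall>j. Suc j < length L \<longrightarrow> 0 < snd (L ! j) \<and> snd (L ! j) < fst (L ! j) \<and> snd (L ! j) < fst (L ! Suc j))"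
proof (induction L)
  case (Cons r L)
  show ?case
  proof (cases L)
    case Nil
    then show ?thesis by auto
  next
    case (Cons r' L')
    then show ?thesis
      using Cons.IH by (auto simp: All_less_Suc2 nth_Cons split: nat.splits)
  qed
qed simp

lemma row_start_Suc: "row_start L (Suc j) = row_start L j + int (fst (L ! j)) - int (snd (L ! j))"
  by (simp add: row_start_def)

lemma stanley_rows_chain:
  assumes "chain L"
  shows "stanley_rows (length L) (row_start L) (row_end L)"
proof -
  have "row_start L (j - 1) < row_start L j \<and> row_start L j \<le> row_end L (j - 1) \<and> row_end L (j - 1) < row_end L j"
    if j: "1 \<le> j" "j \<le> length L - 1" for j
  proof -
    obtain i where "j = Suc i" "Suc i < length L"
      using j by (cases j) auto
    then show ?thesis
      using assms unfolding chain_iff_nth by (auto simp: row_start_Suc row_end_def)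
  qed
  then show ?thesis
    using assms unfolding stanley_rows_def chain_iff_nth by (auto simp: row_end_def Suc_le_eq)
qed

lemma row_cells_eq_imp:
  assumes "row_cells k s e = row_cells k' s' e'" "stanley_rows k s e" "stanley_rows k' s' e'"
  shows "k = k'" "\<And>j. j < k \<Longrightarrow> s j = s' j \<and> e j = e' j"
proof -
  show "k = k'" using row_of_row_cells assms by metis
  fix j assume j: "j < k"
  have "{a. (a, int j) \<in> row_cells k s e} = {s j..e j}" "{a. (a, int j) \<in> row_cells k' s' e'} = {s' j..e' j}"
    using j \<open>k = k'\<close> by (auto simp: mem_row_cells)
  then have "{s j..e j} = {s' j..e' j}" using assms(1) by metis
  moreover have "s j \<le> e j" using assms(2) j by (simp add: stanley_rows_def)
  ultimately show "s j = s' j \<and> e j = e' j" by (simp add: Icc_eq_Icc)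
qed

lemma inj_on_chain_cells: "inj_on chain_cells {L. chain L}"
proof (intro inj_onI)
  fix L L' assume L: "L \<in> {L. chain L}" "L' \<in> {L. chain L}" and eq: "chain_cells L = chain_cells L'"
  note * = row_cells_eq_imp[OF eq[unfolded chain_cells_def] stanley_rows_chain stanley_rows_chain]
  have len: "length L = length L'" using * L by simp
  have se: "row_start L j = row_start L' j \<and> row_end L j = row_end L' j" if "j < length L" for j
    using * L that by simp
  have "L ! j = L' ! j" if j: "j < length L" for j
  proof (rule prod_eqI)
    show fst: "fst (L ! j) = fst (L' ! j)"
      using se[OF j] by (simp add: row_end_def)
    show "snd (L ! j) = snd (L' ! j)"
    proof (cases "Suc j < length L")
      case True
      then show ?thesis
        using se[OF True] se[OF j] fst by (simp add: row_start_Suc)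
    next
      \<comment> \<open>The top row has no successor whose start would reveal the overlap; it is 0
        in every code.\<close>
      case False
      then have "j = length L - 1" "j = length L' - 1" "L \<noteq> []" "L' \<noteq> []"
        using j len by auto
      then have "L ! j = last L" "L' ! j = last L'"
        by (metis last_conv_nth)+
      then show ?thesis using L by (auto simp: chain_iff_nth)
    qed
  qed
  then show "L = L'" using len by (intro nth_equalityI) auto
qed

lemma chain_cells_image: "chain_cells ` {L. chain L} = stanley_polyominoes"
proof
  show "chain_cells ` {L. chain L} \<subseteq> stanley_polyominoes"
    using stanley_rows_chain unfolding stanley_polyominoes_def chain_cells_def
    by (force simp: row_start_def)
  show "stanley_polyominoes \<subseteq> chain_cells ` {L. chain L}"
  proof
    fix P assume "P \<in> stanley_polyominoes"
    then obtain k s e where rows: "stanley_rows k s e" and s0: "s 0 = 0" and P: "P = row_cells k s e"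
      by (auto simp: stanley_polyominoes_def)
    have k: "0 < k" and se: "\<And>j. j < k \<Longrightarrow> s j \<le> e j"
      using rows by (auto simp: stanley_rows_def)
    define L where "L = map (\<lambda>j. (nat (e j - s j + 1),
      if Suc j < k then nat (e j - s (Suc j) + 1) else 0)) [0..<k]"
    have len: "length L = k" by (simp add: L_def)
    have nth: "L ! j = (nat (e j - s j + 1), if Suc j < k then nat (e j - s (Suc j) + 1) else 0)" if "j < k" for j
      using that by (simp add: L_def)
    have start: "row_start L j = s j" if "j < k" for j
      using that
    proof (induction j)
      case 0
      then show ?case by (simp add: row_start_def s0)
    next
      case (Suc j)
      then show ?case using stanley_rowsD[OF rows, of j] by (simp add: row_start_Suc nth)
    qed
    have "end": "row_end L j = e j" if "j < k" for j
      using that se[OF that] by (simp add: row_end_def start nth)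
    have "chain L"
      unfolding chain_iff_nth
    proof (intro conjI allI impI)
      show "L \<noteq> []" using k len by auto
      then show "snd (last L) = 0" using k by (simp add: last_conv_nth len nth)
      show "0 < fst (L ! j)" if "j < length L" for j using that se[of j] by (simp add: len nth)
      fix j assume "Suc j < length L"
      then have j: "Suc j < k" by (simp add: len)
      then show "0 < snd (L ! j)" "snd (L ! j) < fst (L ! j)" "snd (L ! j) < fst (L ! Suc j)"
        using stanley_rowsD[OF rows j] by (simp_all add: nth)
    qed
    moreover have "chain_cells L = P"
      using start "end" unfolding chain_cells_def P len by (auto simp: set_eq_iff mem_row_cells)
    ultimately show "P \<in> chain_cells ` {L. chain L}" by blast
  qed
qed

lemma bij_betw_chain_cells: "bij_betw chain_cells {L. chain L} stanley_polyominoes"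
  using inj_on_chain_cells chain_cells_image by (simp add: bij_betw_def)

section \<open>Statistics and weights in terms of codes\<close>

lemma row_of_chain_cells: "chain L \<Longrightarrow> row_of (chain_cells L) = length L"
  unfolding chain_cells_def by (rule row_of_row_cells[OF stanley_rows_chain])

lemma area_of_chain_cells: "area_of (chain_cells L) = chain_area L"
  by (simp add: chain_cells_def area_of_row_cells row_end_def chain_area_def sum_list_sum_nth atLeast0LessThan)

lemma chain_length_cases:
  assumes "chain L"
  obtains n where "length L = Suc n" "snd (L ! n) = 0"
  using assms unfolding chain_iff_nth by (cases L rule: rev_cases) auto

lemma col_of_chain_cells:
  assumes "chain L"
  shows "col_of (chain_cells L) = (\<Sum>r\<leftarrow>L. fst r - snd r)"
proof -
  obtain n where n: "length L = Suc n" "snd (L ! n) = 0"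
    using assms by (rule chain_length_cases)
  have le: "snd (L ! i) \<le> fst (L ! i)" if "i < length L" for i
    using chain_snd_le[OF assms] that by simp
  have "int (col_of (chain_cells L)) = row_end L n + 1"
    unfolding chain_cells_def col_of_row_cells[OF stanley_rows_chain[OF assms]]
    by (simp add: row_start_def n)
  \<comment> \<open>As the top overlap is 0, a fictitious next row would start just past the end of
    the top row.\<close>
  also have "\<dots> = row_start L (length L)"
    by (simp add: row_end_def row_start_Suc n)
  also have "\<dots> = int (\<Sum>r\<leftarrow>L. fst r - snd r)"
    using le by (simp add: row_start_def sum_list_sum_nth atLeast0LessThan of_nat_diff)
  finally show ?thesis by simp
qed

text \<open>The top overlap is 0 and contributes \<open>f 0 = 0\<close>, so the sum over adjacent
  pairs of rows extends to all rows.\<close>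

lemma sum_overlaps:
  fixes f :: "nat \<Rightarrow> nat"
  assumes "chain L" "f 0 = 0"
  shows "(\<Sum>j<length L - 1. f (snd (L ! j))) = (\<Sum>r\<leftarrow>L. f (snd r))"
proof -
  obtain n where "length L = Suc n" "snd (L ! n) = 0"
    using assms(1) by (rule chain_length_cases)
  then show ?thesis
    using assms(2) by (simp add: sum_list_sum_nth atLeast0LessThan)
qed

lemma overlap_chain: "row_end L j - row_start L (Suc j) = int (snd (L ! j)) - 1"
  by (simp add: row_end_def row_start_Suc)

lemma point_of_chain_cells:
  assumes "chain L"
  shows "point_of (chain_cells L) = (\<Sum>r\<leftarrow>L. snd r - 1)"
proof -
  have "nat (int v - 1) = v - 1" for v by linarith
  then show ?thesis
    unfolding chain_cells_def point_of_row_cells[OF stanley_rows_chain[OF assms]] overlap_chain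
    using sum_overlaps[OF assms, of "\<lambda>v. v - 1"] by simp
qed

lemma edgint_of_chain_cells:
  assumes "chain L"
  shows "edgint_of (chain_cells L) = (\<Sum>r\<leftarrow>L. snd r - 2)"
proof -
  have "nat (int v - 1 - 1) = v - 2" for v by linarith
  then show ?thesis
    unfolding chain_cells_def edgint_of_row_cells[OF stanley_rows_chain[OF assms]] overlap_chain
    using sum_overlaps[OF assms, of "\<lambda>v. v - 2"] by simp
qed

lemma weight_chain_cells:
  assumes "chain L"
  shows "weight (fps_const x) (fps_const y) fps_X (fps_const p) (fps_const q) (chain_cells L)
     = fps_const (chain_weight x y p q L) * fps_X ^ chain_area L"
proof -
  have "chain_weight x y p q L = x ^ (\<Sum>r\<leftarrow>L. fst r - snd r) * y ^ length L
     * p ^ (\<Sum>r\<leftarrow>L. snd r - 2) * q ^ (\<Sum>r\<leftarrow>L. snd r - 1)"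
    unfolding chain_weight_def by (induction L) (auto simp: power_add)
  then show ?thesis
    by (simp add: weight_def assms row_of_chain_cells col_of_chain_cells area_of_chain_cells
        point_of_chain_cells edgint_of_chain_cells fps_const_power mult_ac
        flip: fps_const_mult)
qed

text \<open>Coefficient \<open>N\<close> of a finite partial sum is final once the index set
  contains the finitely many codes of area \<open>N\<close>, which form
  \<open>chains_bottom_gt N 0\<close>.\<close>

lemma has_sum_weight:
  "(weight (fps_const x) (fps_const y) fps_X (fps_const p) (fps_const q) has_sum bottom_gt_gf x y p q 0) stanley_polyominoes"
proof -
  let ?w = "\<lambda>L. fps_const (chain_weight x y p q L) * fps_X ^ chain_area L"
  have "(?w has_sum bottom_gt_gf x y p q 0) {L. chain L}"
    unfolding has_sum_def tendsto_fps_iff eventually_finite_subsets_at_top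
  proof (intro allI exI conjI impI)
    fix N
    show "finite (chains_bottom_gt N 0)" by (rule finite_chains_bottom_gt)
    show "chains_bottom_gt N 0 \<subseteq> {L. chain L}" by (auto simp: chains_bottom_gt_def)
    fix A assume A: "finite A \<and> chains_bottom_gt N 0 \<subseteq> A \<and> A \<subseteq> {L. chain L}"
    have "sum ?w A $ N = (\<Sum>L\<in>A. if chain_area L = N then chain_weight x y p q L else 0)"
      by (auto simp: fps_sum_nth intro!: sum.cong)
    also have "\<dots> = (\<Sum>L\<in>{L \<in> A. chain_area L = N}. chain_weight x y p q L)"
      using A by (simp add: sum.inter_filter)
    also have "{L \<in> A. chain_area L = N} = chains_bottom_gt N 0"
      using A chain_hd_pos by (auto simp: chains_bottom_gt_def)
    finally show "sum ?w A $ N = bottom_gt_gf x y p q 0 $ N"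
      by (simp add: bottom_gt_gf_def)
  qed
  then have "((\<lambda>L. weight (fps_const x) (fps_const y) fps_X (fps_const p) (fps_const q) (chain_cells L))
      has_sum bottom_gt_gf x y p q 0) {L. chain L}"
    by (rule has_sum_cong[THEN iffD2, rotated]) (simp add: weight_chain_cells)
  then show ?thesis
    by (simp only: has_sum_reindex_bij_betw[OF bij_betw_chain_cells])
qed

theorem theorem2p1:
  fixes x0 y0 p0 q0 :: "'a::field" and x y z p q :: "'a fps"
  assumes "p0 \<noteq> 0" and "q0 \<noteq> 0"
  defines "x \<equiv> fps_const x0" and "y \<equiv> fps_const y0" and "z \<equiv> fps_X"
    and "p \<equiv> fps_const p0" and "q \<equiv> fps_const q0"
  shows "weight x y z p q summable_on stanley_polyominoes \<and>
    summable (G_term x y z p q) \<and>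
    summable (H_term x y z p q) \<and>
    is_unit (1 + H_gf x y z p q) \<and>
    F_gf x y z p q = G_gf x y z p q / (1 + H_gf x y z p q) \<and>
    (\<forall>l. Delta x z p q l
          = (-1) ^ l / (qpoch (x * z) (z * p * q) l * qpoch (z * p * q) (z * p * q) l))"
proof -
  let ?F = "bottom_gt_gf x0 y0 p0 q0 0"
  note params = assms(1,2) z_def[THEN meta_eq_to_obj_eq] p_def[THEN meta_eq_to_obj_eq]
    q_def[THEN meta_eq_to_obj_eq]
  have F: "(weight x y z p q has_sum ?F) stanley_polyominoes"
    unfolding x_def y_def z_def p_def q_def by (rule has_sum_weight)
  have eq: "?F * (1 + H_gf x y z p q) = G_gf x y z p q"
    by (rule G_eq_mult_H[OF params, where f = "bottom_gf x0 y0 p0 q0"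
          and g = "bottom_gt_gf x0 y0 p0 q0"])
      (use bottom_gf_dvd bottom_gf_0 bottom_gf_1 bottom_gf_Suc bottom_gt_gf_Suc bottom_gt_gf_0 in
        \<open>simp_all add: x_def y_def z_def p_def q_def\<close>)
  have unit: "(1 + H_gf x y z p q) $ 0 \<noteq> 0"
    by (rule unit_1_plus_H[OF params])
  show ?thesis
  proof (intro conjI allI)
    show "weight x y z p q summable_on stanley_polyominoes"
      using F by (rule has_sum_imp_summable)
    show "summable (G_term x y z p q)"
      by (rule sums_summable, rule sums_zsum, rule G_term_dvd'[OF params])
    show "summable (H_term x y z p q)"
      by (rule sums_summable, rule sums_zsum, rule H_term_dvd'[OF params])
    show "is_unit (1 + H_gf x y z p q)"
      using unit by (simp only: fps_is_unit_iff not_False_eq_True)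
    show "F_gf x y z p q = G_gf x y z p q / (1 + H_gf x y z p q)"
      unfolding F_gf_def infsumI[OF F] using unit eq by (rule fps_eq_divideI)
  qed (rule Delta_eq_qpoch[OF params])
qed

end
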